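(* Let $d\ge2$ be even. For $x,y\in\mathbb{R}$ let $$L_d(x,y)=\frac1{c_d}\,\mathrm{pf}\begin{pmatrix}V-2\bigl(r\,q(y)^\top-q(y)\,r^\top\bigr)&p(x)\\-p(x)^\top&0\end{pmatrix},$$ with $c_d,V,r,q(y),p(x)$ as defined in the context. Then $$L_d(x,y)=2^{-d/2}H_d(\sqrt2x)+\widetilde K_d(x,y),$$ where $$\widetilde K_d(x,y)=\sqrt{\frac1{2\pi}}\Bigl(\frac{d-1}2\Bigr)!\Biggl[2\sum_{k=0}^d\frac{H_k(\sqrt2x)\,e^{-y^2/2}H_k(\sqrt2y)}{k!}+\frac1{2^{1/2}d!}H_d(\sqrt2x)\int_{-\infty}^\infty e^{-t^2/2}H_{d+1}(\sqrt2t)\,\mathrm{sgn}(y-t)\,dt\Biggr].$$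
   Context: $H_n(x)=\phi(x)^{-1}\bigl(-\frac{d}{dx}\bigr)^n\phi(x)$ with $\phi(x)=\frac1{\sqrt{2\pi}}e^{-x^2/2}$ is the (probabilists') Hermite polynomial of degree $n$; $\bigl(\frac{d-1}2\bigr)!=\Gamma\bigl(\frac{d+1}2\bigr)$; $\mathrm{sgn}$ is the sign function; $c_d=2^{d/2}\prod_{i=1}^d\Gamma(i/2)$. The monic polynomials $p_n$ are $p_n(x)=2^{-n/2}H_n(\sqrt2x)$ for $n$ even and $p_n(x)=2^{-n/2}H_n(\sqrt2x)-\frac{n-1}2\,2^{-(n-2)/2}H_{n-2}(\sqrt2x)$ for $n$ odd (the second term is zero for $n=1$); $p(x)=(p_0(x),\ldots,p_d(x))^\top$. Let $\sigma_k=2\sqrt\pi\,\frac{(2k)!}{2^{2k}}$ and let $V$ be the $(d+1)\times(d+1)$ block-diagonal matrix $$V=\mathrm{diag}\left(\begin{pmatrix}0&\sigma_0\\-\sigma_0&0\end{pmatrix},\ldots,\begin{pmatrix}0&\sigma_{d/2-1}\\-\sigma_{d/2-1}&0\end{pmatrix},0\right).$$ Let $q_n(y)=\int_y^\infty p_n(t)e^{-t^2/2}dt$, $r_n=\int_{-\infty}^\infty p_n(t)e^{-t^2/2}dt$ (which equals $2^{-n}\sqrt{2\pi}\,\frac{n!}{(n/2)!}$ for $n$ even and $0$ for $n$ odd), $q(y)=(q_0(y),\ldots,q_d(y))^\top$, $r=(r_0,r_1,\ldots,r_d)^\top=(r_0,0,r_2,0,\ldots,r_d)^\top$. For a skew-symmetric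 $n\times n$ matrix $A=(a_{ij})$ with $n$ even, $\mathrm{pf}(A)=\sum_\pi\mathrm{sgn}(\pi)a_{\pi(1)\pi(2)}\cdots a_{\pi(n-1)\pi(n)}$, the sum being over permutations $\pi$ of $\{1,\dots,n\}$ with $\pi(2k-1)<\pi(2k)$ for all $k$ and $\pi(1)<\pi(3)<\cdots<\pi(n-1)$. *)

theory Defs
  imports
    "HOL-Probability.Distributions"
    "HOL-Combinatorics.Permutations"
    "Jordan_Normal_Form.Matrix"
begin

definition hermite :: "nat \<Rightarrow> real \<Rightarrow> real" where
  "hermite n x = inverse (std_normal_density x) * ((\<lambda>f t. - deriv f t) ^^ n) std_normal_density x"

definition c_const :: "nat \<Rightarrow> real" where
  "c_const d = 2 powr (real d / 2) * (\<Prod>i=1..d. Gamma (real i / 2))"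

(* For n = 1 the index n - 2 is truncated to 0, but the coefficient (n - 1)/2 vanishes. *)
definition p_poly :: "nat \<Rightarrow> real \<Rightarrow> real" where
  "p_poly n x =
    (if even n then 2 powr (- real n / 2) * hermite n (sqrt 2 * x)
     else 2 powr (- real n / 2) * hermite n (sqrt 2 * x)
          - (real n - 1) / 2 * 2 powr (- (real n - 2) / 2) * hermite (n - 2) (sqrt 2 * x))"

definition q_fun :: "nat \<Rightarrow> real \<Rightarrow> real" where
  "q_fun n y = (LBINT t:{y<..}. p_poly n t * exp (- t\<^sup>2 / 2))"

definition r_const :: "nat \<Rightarrow> real" where
  "r_const n = (LBINT t. p_poly n t * exp (- t\<^sup>2 / 2))"

definition sigma_const :: "nat \<Rightarrow> real" where
  "sigma_const k = 2 * sqrt pi * (fact (2 * k) / 2 ^ (2 * k))"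

definition p_vec :: "nat \<Rightarrow> real \<Rightarrow> real vec" where
  "p_vec d x = vec (d + 1) (\<lambda>n. p_poly n x)"

definition q_vec :: "nat \<Rightarrow> real \<Rightarrow> real vec" where
  "q_vec d y = vec (d + 1) (\<lambda>n. q_fun n y)"

definition r_vec :: "nat \<Rightarrow> real vec" where
  "r_vec d = vec (d + 1) r_const"

definition V_mat :: "nat \<Rightarrow> real mat" where
  "V_mat d = diag_block_mat
     (map (\<lambda>k. mat_of_rows_list 2 [[0, sigma_const k], [- sigma_const k, 0]]) [0..<d div 2]
      @ [0\<^sub>m 1 1])"

definition col_mat :: "real vec \<Rightarrow> real mat" where
  "col_mat v = mat_of_cols (dim_vec v) [v]"

(* Matrix indices start at 0, so \<pi>(1), \<pi>(2), ..., \<pi>(n) become \<pi> 0, \<pi> 1, ..., \<pi> (n - 1).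
   Only meaningful for skew-symmetric matrices of even dimension. *)
definition pf :: "real mat \<Rightarrow> real" where
  "pf A = (let n = dim_row A in
     \<Sum>\<pi> | \<pi> permutes {0..<n}
          \<and> (\<forall>k < n div 2. \<pi> (2 * k) < \<pi> (2 * k + 1))
          \<and> (\<forall>k. k + 1 < n div 2 \<longrightarrow> \<pi> (2 * k) < \<pi> (2 * (k + 1))).
       of_int (sign \<pi>) * (\<Prod>k < n div 2. A $$ (\<pi> (2 * k), \<pi> (2 * k + 1))))"

definition L_fun :: "nat \<Rightarrow> real \<Rightarrow> real \<Rightarrow> real" where
  "L_fun d x y =
    (let p = col_mat (p_vec d x); q = col_mat (q_vec d y); r = col_mat (r_vec d) in
     1 / c_const d *
       pf (four_block_mat
             (V_mat d - 2 \<cdot>\<^sub>m (r * transpose_mat q - q * transpose_mat r)) p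
             (- transpose_mat p) (0\<^sub>m 1 1)))"

(* ((d - 1)/2)! stands for Gamma ((d + 1)/2). *)
definition K_tilde :: "nat \<Rightarrow> real \<Rightarrow> real \<Rightarrow> real" where
  "K_tilde d x y =
    sqrt (1 / (2 * pi)) * Gamma ((real d + 1) / 2) *
      (2 * (\<Sum>k=0..d. hermite k (sqrt 2 * x) * exp (- y\<^sup>2 / 2) * hermite k (sqrt 2 * y) / fact k)
       + 1 / (2 powr (1 / 2) * fact d) * hermite d (sqrt 2 * x)
         * (LBINT t. exp (- t\<^sup>2 / 2) * hermite (d + 1) (sqrt 2 * t) * sgn (y - t)))"

end

theory Submission
  imports Defs "Jordan_Normal_Form.Determinant" "HOL-Real_Asymp.Real_Asymp"
begin


text \<open>Read the skew-symmetric matrix as the two-form \<open>v + a + b\<close>, where \<open>v\<close> is the sum of the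
  \<open>\<sigma>\<^sub>k e\<^sub>2\<^sub>k \<and> e\<^sub>2\<^sub>k\<^sub>+\<^sub>1\<close> (the blocks), \<open>a = p(x) \<and> e\<^sub>d\<^sub>+\<^sub>1\<close> (the border) and \<open>b = -2 r \<and> q(y)\<close> (the
  perturbation). Its Pfaffian is the top coefficient of \<open>(v + a + b)\<^sup>m\<^sup>+\<^sup>1 / (m + 1)!\<close> with \<open>d = 2 m\<close>. The
  border is the only part that meets the last index, so it occurs exactly once, and \<open>b \<and> b = 0\<close>, so
  \<open>b\<close> occurs at most once. Hence the Pfaffian is the product of the \<open>\<sigma>\<^sub>k\<close>, which equals \<open>c\<^sub>d\<close> by the
  duplication formula for \<open>\<Gamma>\<close>, times the difference of \<open>p\<^sub>d(x)\<close> and twice the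
  sum over \<open>k\<close> of \<open>D\<^sub>k / \<sigma>\<^sub>k\<close>, where \<open>D\<^sub>k\<close> is the 3 by 3 determinant of \<open>p, r, q\<close> at the indices
  \<open>2 k, 2 k + 1, d\<close>. The proof replaces the exterior algebra
  by a Pfaffian on index lists, defined by expansion along the first row: \<open>pf_eq_pfaff\<close> identifies it
  with the sum over permutations, \<open>pfaff_adjacent\<close> splits off one block, and the vanishing of the
  remaining terms is \<open>pfaff_rank_four_eq_0\<close>. The outcome is \<open>L_fun_expansion\<close>.\<close>

text \<open>What remains are sums of Gaussian integrals. Write \<open>h\<^sub>n\<close> for the monic polynomial proportional to
  \<open>H\<^sub>n(\<surd>2 x)\<close> and \<open>g(t) = exp (- t\<^sup>2 / 2)\<close>. The derivative of \<open>h\<^sub>2\<^sub>k g\<close> is \<open>- p\<^sub>2\<^sub>k\<^sub>+\<^sub>1 g\<close>, so the odd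
  entries of \<open>q(y)\<close> are explicit and those of \<open>r\<close> vanish. The even entries satisfy the recursion
  \<open>q\<^sub>2\<^sub>k\<^sub>+\<^sub>2 = (2 k + 1) / 2 q\<^sub>2\<^sub>k + h\<^sub>2\<^sub>k\<^sub>+\<^sub>1(y) g(y)\<close>, and \<open>r\<^sub>2\<^sub>k\<close> satisfies the same one without the last
  term. Three things then happen in the sum over \<open>k\<close>. The products \<open>p\<^sub>2\<^sub>k(x) q\<^sub>2\<^sub>k\<^sub>+\<^sub>1(y)\<close> are the even terms
  of the kernel as they stand. The terms with \<open>p\<^sub>2\<^sub>k\<^sub>+\<^sub>1(x)\<close> carry the differences of the quotients
  \<open>q\<^sub>2\<^sub>k / r\<^sub>2\<^sub>k\<close> between \<open>k\<close> and \<open>m\<close>, and \<open>p\<^sub>2\<^sub>k\<^sub>+\<^sub>1 / k!\<close> is a difference of consecutive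
  \<open>h\<^sub>2\<^sub>k\<^sub>+\<^sub>1 / k!\<close>; summation by parts turns them into the odd terms. The terms with \<open>p\<^sub>d(x)\<close> add up, by
  \<open>sum_mherm_even\<close>, to the term of degree \<open>d\<close> together with the integral against the sign function.\<close>

section \<open>Pfaffians by expansion along the first row\<close>

definition drop_nth :: "nat \<Rightarrow> 'i list \<Rightarrow> 'i list" where
  "drop_nth k xs = take k xs @ drop (Suc k) xs"

lemma length_drop_nth [simp]: "k < length xs \<Longrightarrow> length (drop_nth k xs) = length xs - 1"
  by (simp add: drop_nth_def)

lemma nth_drop_nth:
  "k < length xs \<Longrightarrow> i < length xs - 1 \<Longrightarrow> drop_nth k xs ! i = xs ! insert_index k i"
  by (auto simp: drop_nth_def nth_append insert_index_def min_def)

lemma drop_nth_Cons_0 [simp]: "drop_nth 0 (x # xs) = xs"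
  by (simp add: drop_nth_def)

lemma drop_nth_Cons_Suc [simp]: "drop_nth (Suc k) (x # xs) = x # drop_nth k xs"
  by (simp add: drop_nth_def)

lemma drop_nth_append_left: "k < length A \<Longrightarrow> drop_nth k (A @ B) = drop_nth k A @ B"
  by (simp add: drop_nth_def)

lemma drop_nth_append_right: "drop_nth (length A + k) (A @ B) = A @ drop_nth k B"
  by (simp add: drop_nth_def)

lemma set_drop_nth_subset: "set (drop_nth k xs) \<subseteq> set xs"
  using set_take_subset[of k xs] set_drop_subset[of "Suc k" xs] by (auto simp: drop_nth_def)

lemma distinct_drop_nth: "distinct xs \<Longrightarrow> distinct (drop_nth k xs)"
  by (simp add: drop_nth_def set_take_disj_set_drop_if_distinct)

lemma insert_index_less_iff: "insert_index k i < insert_index k j \<longleftrightarrow> i < j"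
  by (auto simp: insert_index_def)

lemma insert_index_bound: "i < n \<Longrightarrow> insert_index k i < Suc n"
  by (auto simp: insert_index_def)

text \<open>Indexing by lists instead of matrices makes every minor of the expansion an instance of the
  same function.\<close>

function pfaff :: "('i \<Rightarrow> 'i \<Rightarrow> 'a::comm_ring_1) \<Rightarrow> 'i list \<Rightarrow> 'a" where
  "pfaff f [] = 1"
| "pfaff f (x # xs) = (\<Sum>k<length xs. (-1) ^ k * f x (xs ! k) * pfaff f (drop_nth k xs))"
  by pat_completeness auto
termination by (relation "Wellfounded.measure (\<lambda>(f, xs). length xs)") auto

text \<open>Expansion along the first row pairs each index only with later ones, so entries on or below
  the diagonal never enter.\<close>

lemma pfaff_cong:
  assumes "\<And>i j. i < j \<Longrightarrow> j < length xs \<Longrightarrow> f (xs ! i) (xs ! j) = g (xs ! i) (xs ! j)"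
  shows "pfaff f xs = pfaff g xs"
  using assms
proof (induction "length xs" arbitrary: xs rule: less_induct)
  case less
  show ?case
  proof (cases xs)
    case (Cons x ys)
    have "f x (ys ! k) = g x (ys ! k)" if "k < length ys" for k
      using less.prems[of 0 "Suc k"] that by (simp add: Cons)
    moreover have "pfaff f (drop_nth k ys) = pfaff g (drop_nth k ys)" if k: "k < length ys" for k
    proof (rule less.hyps)
      show "length (drop_nth k ys) < length xs"
        using k by (simp add: Cons)
      fix i j assume ij: "i < j" "j < length (drop_nth k ys)"
      have "insert_index k i < insert_index k j" "insert_index k j < length ys"
        using ij k insert_index_bound[of j "length ys - 1" k] by (auto simp: insert_index_less_iff)
      then show "f (drop_nth k ys ! i) (drop_nth k ys ! j) = g (drop_nth k ys ! i) (drop_nth k ys ! j)"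
        using ij k less.prems[of "Suc (insert_index k i)" "Suc (insert_index k j)"]
        by (simp add: Cons nth_drop_nth)
    qed
    ultimately show ?thesis
      by (simp add: Cons)
  qed simp
qed

text \<open>Each of these permutations represents one perfect matching of \<open>{0..<2 * N}\<close>: it lists the pairs,
  smaller element first, by increasing smaller element.\<close>

definition matchings :: "nat \<Rightarrow> (nat \<Rightarrow> nat) set" where
  "matchings N = {\<pi>. \<pi> permutes {0..<2 * N}
      \<and> (\<forall>k<N. \<pi> (2 * k) < \<pi> (2 * k + 1))
      \<and> (\<forall>k. k + 1 < N \<longrightarrow> \<pi> (2 * k) < \<pi> (2 * (k + 1)))}"

text \<open>The matching that joins \<open>0\<close> to \<open>Suc j\<close> and follows \<open>\<tau>\<close> on the other indices, renumbered in
  order.\<close>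

definition add_pair :: "nat \<Rightarrow> (nat \<Rightarrow> nat) \<Rightarrow> nat \<Rightarrow> nat" where
  "add_pair j \<tau> = permutation_insert 0 0 (permutation_insert 0 j \<tau>)"

lemma add_pair_simps [simp]:
  "add_pair j \<tau> 0 = 0"
  "add_pair j \<tau> (Suc 0) = Suc j"
  "add_pair j \<tau> (Suc (Suc k)) = Suc (insert_index j (\<tau> k))"
  by (simp_all add: add_pair_def permutation_insert_expand insert_index_def)

lemma add_pair_permutes:
  assumes "\<tau> permutes {0..<2 * N}" "j < 2 * N + 1"
  shows "add_pair j \<tau> permutes {0..<2 * Suc N}"
  using permutation_insert_permutes[OF permutation_insert_permutes[OF assms(1), of 0 j], of 0 0] assms(2)
  by (simp add: add_pair_def)

lemma sign_add_pair:
  assumes "\<tau> permutes {0..<2 * N}" "j < 2 * N + 1"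
  shows "(of_int (sign (add_pair j \<tau>)) :: 'a::ring_1) = (-1) ^ j * of_int (sign \<tau>)"
  using signof_permutation_insert[OF permutation_insert_permutes[OF assms(1), of 0 j], of 0 0, where 'a='a]
    signof_permutation_insert[OF assms(1), of 0 j, where 'a='a] assms(2)
  by (simp add: add_pair_def)

lemma matchings_0: "matchings 0 = {id}"
  by (auto simp: matchings_def)

lemma add_pair_mem_matchings_iff:
  assumes "\<tau> permutes {0..<2 * N}" "j < 2 * N + 1"
  shows "add_pair j \<tau> \<in> matchings (Suc N) \<longleftrightarrow> \<tau> \<in> matchings N"
proof -
  have 1: "(\<forall>k<Suc N. add_pair j \<tau> (2 * k) < add_pair j \<tau> (2 * k + 1))
      \<longleftrightarrow> (\<forall>k<N. \<tau> (2 * k) < \<tau> (2 * k + 1))"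
    by (simp add: All_less_Suc2 insert_index_less_iff)
  have "(\<forall>k. k + 1 < Suc N \<longrightarrow> add_pair j \<tau> (2 * k) < add_pair j \<tau> (2 * (k + 1)))
      \<longleftrightarrow> (\<forall>k<N. add_pair j \<tau> (2 * k) < add_pair j \<tau> (2 * (k + 1)))"
    by simp
  also have "\<dots> \<longleftrightarrow> (\<forall>k. k + 1 < N \<longrightarrow> \<tau> (2 * k) < \<tau> (2 * (k + 1)))"
    by (cases N) (auto simp: All_less_Suc2 insert_index_less_iff)
  finally show ?thesis
    using 1 add_pair_permutes[OF assms] assms(1) by (simp add: matchings_def)
qed

text \<open>The index \<open>0\<close> must be the smaller element of its pair, and the pairs are listed by increasing
  smaller element.\<close>

lemma matching_zero:
  assumes "\<pi> \<in> matchings (Suc N)"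
  shows "\<pi> 0 = 0"
proof -
  have perm: "\<pi> permutes {0..<2 * Suc N}"
    and pair: "\<And>k. k < Suc N \<Longrightarrow> \<pi> (2 * k) < \<pi> (2 * k + 1)"
    and incr: "\<And>k. k + 1 < Suc N \<Longrightarrow> \<pi> (2 * k) < \<pi> (2 * (k + 1))"
    using assms by (auto simp: matchings_def)
  obtain i where i: "i < 2 * Suc N" "\<pi> i = 0"
  proof -
    have "0 \<in> \<pi> ` {0..<2 * Suc N}"
      unfolding permutes_image[OF perm] by simp
    then show ?thesis
      using that by (metis atLeastLessThan_iff imageE)
  qed
  show ?thesis
  proof (cases "i = 0")
    case False
    then have "i = 2 * ((i - 1) div 2) + 1 \<or> i = 2 * ((i - 1) div 2 + 1)"
      by presburger
    then obtain k where "i = 2 * k + 1 \<or> i = 2 * (k + 1)" ..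
    then show ?thesis
      using pair[of k] incr[of k] i by auto
  qed (use i in simp)
qed

text \<open>Sorting the matchings by the partner of \<open>0\<close> is what produces the first-row expansion.\<close>

lemma bij_betw_add_pair:
  "bij_betw (\<lambda>(j, \<tau>). add_pair j \<tau>) ({..<2 * N + 1} \<times> matchings N) (matchings (Suc N))"
proof (rule bij_betw_imageI)
  have inj: "j = j' \<and> \<tau> = \<tau>'" if eq: "add_pair j \<tau> = add_pair j' \<tau>'" for j j' \<tau> \<tau>'
  proof -
    have j: "j = j'"
      using fun_cong[OF eq, of "Suc 0"] by simp
    moreover have "\<tau> k = \<tau>' k" for k
      using fun_cong[OF eq, of "Suc (Suc k)"] j by simp (metis delete_insert_index)
    ultimately show ?thesis by auto
  qed
  show "inj_on (\<lambda>(j, \<tau>). add_pair j \<tau>) ({..<2 * N + 1} \<times> matchings N)"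
    by (intro inj_onI) (simp add: case_prod_unfold prod_eq_iff inj)
  show "(\<lambda>(j, \<tau>). add_pair j \<tau>) ` ({..<2 * N + 1} \<times> matchings N) = matchings (Suc N)"
  proof
    show "(\<lambda>(j, \<tau>). add_pair j \<tau>) ` ({..<2 * N + 1} \<times> matchings N) \<subseteq> matchings (Suc N)"
      using add_pair_mem_matchings_iff by (fastforce simp: matchings_def)
    show "matchings (Suc N) \<subseteq> (\<lambda>(j, \<tau>). add_pair j \<tau>) ` ({..<2 * N + 1} \<times> matchings N)"
    proof
      fix \<pi> assume \<pi>: "\<pi> \<in> matchings (Suc N)"
      then have "\<pi> permutes {0..<Suc (Suc (2 * N))}"
        by (simp add: matchings_def)
      then obtain \<rho> where \<rho>: "\<rho> permutes {0..<Suc (2 * N)}" "\<pi> = permutation_insert 0 0 \<rho>"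
        using permutation_fix[of 0 "Suc (2 * N)" 0] matching_zero[OF \<pi>] by auto
      have less: "\<rho> 0 < Suc (2 * N)"
        using permutes_in_image[OF \<rho>(1), of 0] by simp
      then obtain \<tau> where \<tau>: "\<tau> permutes {0..<2 * N}" "\<rho> = permutation_insert 0 (\<rho> 0) \<tau>"
        using permutation_fix[of 0 "2 * N" "\<rho> 0"] \<rho>(1) by auto
      have eq: "\<pi> = add_pair (\<rho> 0) \<tau>"
        unfolding add_pair_def using \<rho>(2) \<tau>(2) by simp
      then have "\<tau> \<in> matchings N"
        using add_pair_mem_matchings_iff[OF \<tau>(1)] less \<pi> by simp
      then show "\<pi> \<in> (\<lambda>(j, \<tau>). add_pair j \<tau>) ` ({..<2 * N + 1} \<times> matchings N)"
        using eq less by force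
    qed
  qed
qed

lemma sum_matchings_eq_pfaff:
  fixes f :: "'i \<Rightarrow> 'i \<Rightarrow> 'a::comm_ring_1"
  assumes "length xs = 2 * N"
  shows "(\<Sum>\<pi>\<in>matchings N. of_int (sign \<pi>) * (\<Prod>k<N. f (xs ! \<pi> (2 * k)) (xs ! \<pi> (2 * k + 1))))
      = pfaff f xs"
  using assms
proof (induction N arbitrary: xs)
  case 0
  then show ?case by (simp add: matchings_0)
next
  case (Suc N)
  then obtain x ys where xs: "xs = x # ys" and len: "length ys = 2 * N + 1"
    by (cases xs) auto
  define w where "w \<pi> = of_int (sign \<pi>) *
    (\<Prod>k<Suc N. f (xs ! \<pi> (2 * k)) (xs ! \<pi> (2 * k + 1)))" for \<pi>
  have w: "w (add_pair j \<tau>) = (-1) ^ j * f x (ys ! j) * (of_int (sign \<tau>) *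
      (\<Prod>k<N. f (drop_nth j ys ! \<tau> (2 * k)) (drop_nth j ys ! \<tau> (2 * k + 1))))"
    if j: "j < 2 * N + 1" and \<tau>: "\<tau> \<in> matchings N" for j \<tau>
  proof -
    have perm: "\<tau> permutes {0..<2 * N}"
      using \<tau> by (simp add: matchings_def)
    have "ys ! insert_index j (\<tau> i) = drop_nth j ys ! \<tau> i" if "i < 2 * N" for i
      using permutes_in_image[OF perm, of i] that j len by (subst nth_drop_nth) auto
    then have "(\<Prod>k<N. f (ys ! insert_index j (\<tau> (2 * k))) (ys ! insert_index j (\<tau> (2 * k + 1))))
      = (\<Prod>k<N. f (drop_nth j ys ! \<tau> (2 * k)) (drop_nth j ys ! \<tau> (2 * k + 1)))"
      by (intro prod.cong) auto
    then show ?thesis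
      by (simp add: w_def sign_add_pair[OF perm j] prod.lessThan_Suc_shift xs mult_ac del: prod.lessThan_Suc)
  qed
  have "(\<Sum>\<pi>\<in>matchings (Suc N). w \<pi>) = (\<Sum>(j, \<tau>)\<in>{..<2 * N + 1} \<times> matchings N. w (add_pair j \<tau>))"
    using sum.reindex_bij_betw[OF bij_betw_add_pair, of w N] by (simp add: case_prod_unfold)
  also have "\<dots> = (\<Sum>j<2 * N + 1. \<Sum>\<tau>\<in>matchings N. w (add_pair j \<tau>))"
    by (simp only: sum.cartesian_product)
  also have "\<dots> = (\<Sum>j<2 * N + 1. (-1) ^ j * f x (ys ! j) * pfaff f (drop_nth j ys))"
  proof (rule sum.cong[OF refl])
    fix j assume "j \<in> {..<2 * N + 1}"
    then have j: "j < 2 * N + 1" by simp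
    show "(\<Sum>\<tau>\<in>matchings N. w (add_pair j \<tau>)) = (-1) ^ j * f x (ys ! j) * pfaff f (drop_nth j ys)"
      using Suc.IH[of "drop_nth j ys"] j len
      by (simp add: w sum_distrib_left[symmetric])
  qed
  finally show ?case
    by (simp add: w_def[abs_def] xs len)
qed

lemma pf_eq_pfaff:
  assumes "dim_row A = 2 * N"
  shows "pf A = pfaff (\<lambda>i j. A $$ (i, j)) [0..<2 * N]"
proof -
  have "pf A = (\<Sum>\<pi>\<in>matchings N. of_int (sign \<pi>) * (\<Prod>k<N. A $$ (\<pi> (2 * k), \<pi> (2 * k + 1))))"
    by (simp add: pf_def assms matchings_def)
  also have "\<dots> = (\<Sum>\<pi>\<in>matchings N. of_int (sign \<pi>) *
      (\<Prod>k<N. A $$ ([0..<2 * N] ! \<pi> (2 * k), [0..<2 * N] ! \<pi> (2 * k + 1))))"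
  proof (intro sum.cong refl, rule arg_cong[where f="\<lambda>t. _ * t"], rule prod.cong[OF refl])
    fix \<pi> k assume \<pi>: "\<pi> \<in> matchings N" and k: "k \<in> {..<N}"
    have perm: "\<pi> permutes {0..<2 * N}"
      using \<pi> by (simp add: matchings_def)
    show "A $$ (\<pi> (2 * k), \<pi> (2 * k + 1)) =
        A $$ ([0..<2 * N] ! \<pi> (2 * k), [0..<2 * N] ! \<pi> (2 * k + 1))"
      using permutes_in_image[OF perm, of "2 * k"] permutes_in_image[OF perm, of "2 * k + 1"] k
      by simp
  qed
  also have "\<dots> = pfaff (\<lambda>i j. A $$ (i, j)) [0..<2 * N]"
    using sum_matchings_eq_pfaff[of "[0..<2 * N]" N "\<lambda>i j. A $$ (i, j)"] by simp
  finally show ?thesis .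
qed

section \<open>Block-diagonal forms perturbed by a form of rank four\<close>

lemma sum_lessThan_add:
  fixes h :: "nat \<Rightarrow> 'a::comm_monoid_add"
  shows "(\<Sum>k<m + n. h k) = (\<Sum>k<m. h k) + (\<Sum>k<n. h (m + k))"
  by (induction n) (simp_all add: add.assoc)

text \<open>The Pfaffian is affine in each single entry, with a signed minor as the slope. For two
  neighbouring indices the sign is positive wherever they stand, because every index before them
  passes over both or neither.\<close>

lemma pfaff_adjacent:
  fixes f g :: "'i \<Rightarrow> 'i \<Rightarrow> 'a::comm_ring_1"
  assumes "distinct (A @ i # j # B)"
    and fg: "\<And>a b. (a, b) \<noteq> (i, j) \<Longrightarrow> f a b = g a b"
  shows "pfaff f (A @ i # j # B) = (f i j - g i j) * pfaff g (A @ B) + pfaff g (A @ i # j # B)"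
  using assms(1)
proof (induction "length A + length B" arbitrary: A B rule: less_induct)
  case less
  have same: "pfaff f xs = pfaff g xs" if "i \<notin> set xs \<or> j \<notin> set xs" for xs
    using that by (intro pfaff_cong fg) (metis nth_mem less_trans prod.inject)
  show ?case
  proof (cases A)
    case Nil
    have "pfaff f B = pfaff g B" 
      using less.prems Nil by (intro same) auto
    moreover have "pfaff f (j # drop_nth k B) = pfaff g (j # drop_nth k B)" for k
      using less.prems Nil set_drop_nth_subset[of k B] by (intro same) auto
    moreover have "f i (B ! k) = g i (B ! k)" if "k < length B" for k
      using less.prems Nil that by (intro fg) auto
    ultimately show ?thesis
      by (simp add: Nil sum.lessThan_Suc_shift algebra_simps del: sum.lessThan_Suc pfaff.simps(2)
          add: pfaff.simps(2)[of _ i])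
  next
    case (Cons a A')
    let ?p = "length A'" and ?q = "length B"
    have split: "pfaff h (a # A' @ i # j # B) =
        (\<Sum>k<?p. (-1) ^ k * h a (A' ! k) * pfaff h (drop_nth k A' @ i # j # B))
      + ((-1) ^ ?p * h a i * pfaff h (A' @ j # B) - (-1) ^ ?p * h a j * pfaff h (A' @ i # B))
      + (\<Sum>k<?q. (-1) ^ (?p + k) * h a (B ! k) * pfaff h (A' @ i # j # drop_nth k B))"
      for h :: "'i \<Rightarrow> 'i \<Rightarrow> 'a"
    proof -
      have d: "drop_nth ?p (A' @ i # j # B) = A' @ j # B"
        "drop_nth (Suc ?p) (A' @ i # j # B) = A' @ i # B"
        "drop_nth (Suc (Suc (?p + k))) (A' @ i # j # B) = A' @ i # j # drop_nth k B" for k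
        using drop_nth_append_right[of A' 0 "i # j # B"] drop_nth_append_right[of A' 1 "i # j # B"]
          drop_nth_append_right[of A' "Suc (Suc k)" "i # j # B"] by simp_all
      have n: "(A' @ i # j # B) ! Suc ?p = j" "(A' @ i # j # B) ! Suc (Suc (?p + k)) = B ! k" for k
        by (simp_all add: nth_append)
      have "pfaff h (a # A' @ i # j # B) = (\<Sum>k<?p + Suc (Suc ?q).
          (-1) ^ k * h a ((A' @ i # j # B) ! k) * pfaff h (drop_nth k (A' @ i # j # B)))"
        by simp
      also have "\<dots> = (\<Sum>k<?p. (-1) ^ k * h a (A' ! k) * pfaff h (drop_nth k A' @ i # j # B))
        + (\<Sum>k<Suc (Suc ?q). (-1) ^ (?p + k) * h a ((A' @ i # j # B) ! (?p + k)) *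
            pfaff h (drop_nth (?p + k) (A' @ i # j # B)))"
        unfolding sum_lessThan_add
        by (rule arg_cong2[where f=plus]) (auto intro!: sum.cong simp: nth_append drop_nth_append_left)
      also have "(\<Sum>k<Suc (Suc ?q). (-1) ^ (?p + k) * h a ((A' @ i # j # B) ! (?p + k)) *
            pfaff h (drop_nth (?p + k) (A' @ i # j # B))) =
          ((-1) ^ ?p * h a i * pfaff h (A' @ j # B) - (-1) ^ ?p * h a j * pfaff h (A' @ i # B))
          + (\<Sum>k<?q. (-1) ^ (?p + k) * h a (B ! k) * pfaff h (A' @ i # j # drop_nth k B))"
        unfolding sum.lessThan_Suc_shift by (simp add: d n)
      finally show ?thesis by (simp add: algebra_simps)
    qed
    have short: "pfaff h (a # A' @ B) =
        (\<Sum>k<?p. (-1) ^ k * h a (A' ! k) * pfaff h (drop_nth k A' @ B))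
      + (\<Sum>k<?q. (-1) ^ (?p + k) * h a (B ! k) * pfaff h (A' @ drop_nth k B))"
      for h :: "'i \<Rightarrow> 'i \<Rightarrow> 'a"
      unfolding pfaff.simps length_append sum_lessThan_add
      by (rule arg_cong2[where f=plus])
        (auto intro!: sum.cong simp: nth_append drop_nth_append_left drop_nth_append_right)
    have ne: "a \<noteq> i" "i \<noteq> j"
      using less.prems Cons by auto
    then have fga: "f a b = g a b" for b
      by (intro fg) auto
    have m: "pfaff f (A' @ j # B) = pfaff g (A' @ j # B)" "pfaff f (A' @ i # B) = pfaff g (A' @ i # B)"
      using less.prems Cons by (auto intro!: same)
    have l: "pfaff f (drop_nth k A' @ i # j # B) = (f i j - g i j) * pfaff g (drop_nth k A' @ B)
        + pfaff g (drop_nth k A' @ i # j # B)" if "k < ?p" for k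
      using less.hyps[of "drop_nth k A'" B] less.prems Cons that set_drop_nth_subset[of k A']
        distinct_drop_nth[of A' k] by fastforce
    have r: "pfaff f (A' @ i # j # drop_nth k B) = (f i j - g i j) * pfaff g (A' @ drop_nth k B)
        + pfaff g (A' @ i # j # drop_nth k B)" if "k < ?q" for k
      using less.hyps[of A' "drop_nth k B"] less.prems Cons that set_drop_nth_subset[of k B]
        distinct_drop_nth[of B k] by fastforce
    show ?thesis
      by (simp add: Cons split short m fga l r sum_distrib_left algebra_simps sum.distrib
          sum_subtractf del: pfaff.simps)
  qed
qed

text \<open>The two-form \<open>p \<and> e\<^sub>l + c (r \<and> q)\<close>, correct on pairs \<open>(a, b)\<close> in which \<open>l\<close> can only stand second;
  this is all that is seen by a list that ends in \<open>l\<close>.\<close>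

definition rank_four :: "'i \<Rightarrow> 'a \<Rightarrow> ('i \<Rightarrow> 'a) \<Rightarrow> ('i \<Rightarrow> 'a) \<Rightarrow> ('i \<Rightarrow> 'a) \<Rightarrow> 'i \<Rightarrow> 'i \<Rightarrow> 'a::comm_ring_1" where
  "rank_four l c p r q a b = (if b = l then p a else c * (r a * q b - q a * r b))"

text \<open>This is \<open>(r \<and> q) \<and> (r \<and> q) = 0\<close>: for four indices it is the Pluecker relation, and every longer
  Pfaffian expands into shorter ones.\<close>

lemma pfaff_rank_two_eq_0:
  assumes "l \<notin> set xs" "even (length xs)" "length xs \<ge> 4"
  shows "pfaff (rank_four l c p r q) xs = 0"
  using assms
proof (induction "length xs" arbitrary: xs rule: less_induct)
  case less
  show ?case
  proof (cases "length xs = 4")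
    case True
    then obtain a1 a2 a3 a4 where xs: "xs = [a1, a2, a3, a4]"
      by (auto simp: eval_nat_numeral length_Suc_conv)
    have "a1 \<noteq> l" "a2 \<noteq> l" "a3 \<noteq> l" "a4 \<noteq> l"
      using less.prems(1) by (auto simp: xs)
    then show ?thesis
      unfolding xs by (simp add: rank_four_def lessThan_Suc algebra_simps)
  next
    case False
    then obtain x ys where xs: "xs = x # ys"
      using less.prems by (cases xs) auto
    have "length ys > 4"
      using less.prems False xs by (cases "length ys = 4") auto
    then have "pfaff (rank_four l c p r q) (drop_nth k ys) = 0" if "k < length ys" for k
      using less.prems that set_drop_nth_subset[of k ys]
      by (intro less.hyps) (auto simp: xs)
    then show ?thesis by (simp add: xs)
  qed
qed

text \<open>A form of rank four has vanishing third wedge power, which settles six indices. In the expansion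
  of a longer list the minors that keep \<open>l\<close> vanish by induction, and the one that loses \<open>l\<close> has
  rank two.\<close>

lemma pfaff_rank_four_eq_0:
  assumes "l \<notin> set xs" "odd (length xs)" "length xs \<ge> 5"
  shows "pfaff (rank_four l c p r q) (xs @ [l]) = 0"
  using assms
proof (induction "length xs" arbitrary: xs rule: less_induct)
  case less
  show ?case
  proof (cases "length xs = 5")
    case True
    then obtain a1 a2 a3 a4 a5 where xs: "xs = [a1, a2, a3, a4, a5]"
      by (auto simp: eval_nat_numeral length_Suc_conv)
    have "a1 \<noteq> l" "a2 \<noteq> l" "a3 \<noteq> l" "a4 \<noteq> l" "a5 \<noteq> l"
      using less.prems(1) by (auto simp: xs)
    then show ?thesis
      unfolding xs by (simp add: rank_four_def lessThan_Suc algebra_simps)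
  next
    case False
    then obtain x ys where xs: "xs = x # ys"
      using less.prems by (cases xs) auto
    have len: "length ys > 5"
      using less.prems False xs by (cases "length ys = 5") auto
    then have "pfaff (rank_four l c p r q) (drop_nth k ys @ [l]) = 0" if "k < length ys" for k
      using less.prems that set_drop_nth_subset[of k ys]
      by (intro less.hyps) (auto simp: xs)
    moreover have "pfaff (rank_four l c p r q) ys = 0"
      using less.prems len by (intro pfaff_rank_two_eq_0) (auto simp: xs)
    ultimately show ?thesis
      using drop_nth_append_right[of ys 0 "[l]"] by (simp add: xs drop_nth_append_left)
  qed
qed

text \<open>The form \<open>f\<close> plus the blocks with numbers \<open>k\<close> to \<open>m - 1\<close>. The lower bound \<open>k\<close> is a parameter so that
  the blocks can be removed one at a time, from the first on.\<close>

definition block_pert :: "(nat \<Rightarrow> 'a) \<Rightarrow> (nat \<Rightarrow> nat \<Rightarrow> 'a) \<Rightarrow> nat \<Rightarrow> nat \<Rightarrow> nat \<Rightarrow> nat \<Rightarrow> 'a::comm_ring_1" where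
  "block_pert \<sigma> f m k a b =
    f a b + (if even a \<and> b = Suc a \<and> 2 * k \<le> a \<and> a < 2 * m then \<sigma> (a div 2) else 0)"

lemma block_pert_top: "block_pert \<sigma> f m m = f"
  by (auto simp: fun_eq_iff block_pert_def)

text \<open>Either block \<open>k\<close> contributes its weight and its two indices disappear, or the indices stay and
  have to be matched by the base form; \<open>A\<close> collects the indices of the second kind.\<close>

lemma pfaff_block_step:
  assumes "distinct A" "set A \<subseteq> {..<2 * k}" "k < m"
  shows "pfaff (block_pert \<sigma> f m k) (A @ [2 * k..<2 * m + 2]) =
      \<sigma> k * pfaff (block_pert \<sigma> f m (Suc k)) (A @ [2 * Suc k..<2 * m + 2])
    + pfaff (block_pert \<sigma> f m (Suc k)) ((A @ [2 * k, Suc (2 * k)]) @ [2 * Suc k..<2 * m + 2])"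
proof -
  have upt: "[2 * k..<2 * m + 2] = 2 * k # Suc (2 * k) # [2 * Suc k..<2 * m + 2]"
    using assms(3) by (simp add: upt_conv_Cons)
  have d: "distinct (A @ 2 * k # Suc (2 * k) # [2 * Suc k..<2 * m + 2])"
    using assms(1,2) by fastforce
  have e: "block_pert \<sigma> f m k a b = block_pert \<sigma> f m (Suc k) a b" if "(a, b) \<noteq> (2 * k, Suc (2 * k))" for a b
  proof -
    have "(even a \<and> b = Suc a \<and> 2 * k \<le> a \<and> a < 2 * m) \<longleftrightarrow> (even a \<and> b = Suc a \<and> 2 * Suc k \<le> a \<and> a < 2 * m)"
      using that by (auto elim!: evenE)
    then show ?thesis by (simp add: block_pert_def)
  qed
  show ?thesis
    unfolding upt using pfaff_adjacent[OF d, of "block_pert \<sigma> f m k" "block_pert \<sigma> f m (Suc k)", OF e] assms(3) by (simp add: block_pert_def)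
qed

context
  fixes m :: nat and c :: "'a::field" and p r q :: "nat \<Rightarrow> 'a" and \<sigma> :: "nat \<Rightarrow> 'a"
begin

private abbreviation "base \<equiv> rank_four (2 * m + 1) c p r q"

text \<open>If two blocks have been passed over, then at least six indices are left to the base form in the
  end.\<close>

lemma pfaff_block_pert_eq_0:
  assumes "k \<le> m" "distinct A" "set A \<subseteq> {..<2 * k}" "even (length A)" "length A \<ge> 4"
  shows "pfaff (block_pert \<sigma> base m k) (A @ [2 * k..<2 * m + 2]) = 0"
  using assms
proof (induction k arbitrary: A rule: inc_induct)
  case base
  have "pfaff base ((A @ [2 * m]) @ [2 * m + 1]) = 0"
    using base by (intro pfaff_rank_four_eq_0) auto
  then show ?case by (simp add: block_pert_top upt_conv_Cons)
next
  case (step k)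
  have "pfaff (block_pert \<sigma> base m (Suc k)) (A @ [2 * Suc k..<2 * m + 2]) = 0"
    using step.prems by (intro step.IH) auto
  moreover have "pfaff (block_pert \<sigma> base m (Suc k)) ((A @ [2 * k, Suc (2 * k)]) @ [2 * Suc k..<2 * m + 2]) = 0"
    using step.prems by (intro step.IH) auto
  ultimately show ?case
    using pfaff_block_step[of A k m \<sigma> base] step by simp
qed

lemma pfaff_block_pert_pair:
  assumes "k \<le> m" "a < 2 * k" "b < 2 * k" "a \<noteq> b"
  shows "pfaff (block_pert \<sigma> base m k) ([a, b] @ [2 * k..<2 * m + 2]) =
    (\<Prod>j=k..<m. \<sigma> j) * pfaff base [a, b, 2 * m, 2 * m + 1]"
  using assms
proof (induction k rule: inc_induct)
  case base
  then show ?case by (simp add: block_pert_top upt_conv_Cons del: pfaff.simps)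
next
  case (step k)
  have "pfaff (block_pert \<sigma> base m (Suc k)) (([a, b] @ [2 * k, Suc (2 * k)]) @ [2 * Suc k..<2 * m + 2]) = 0"
    using step by (intro pfaff_block_pert_eq_0) auto
  then show ?case
    using pfaff_block_step[of "[a, b]" k m \<sigma> base] step
    by (simp add: prod.atLeast_Suc_lessThan mult.assoc del: pfaff.simps)
qed

text \<open>By the preceding two lemmas at most one block is passed over: the first summand arises when all
  blocks contribute, the summand for \<open>j\<close> when block \<open>j\<close> does not.\<close>

lemma pfaff_block_pert:
  assumes "k \<le> m" "\<And>j. \<sigma> j \<noteq> 0"
  shows "pfaff (block_pert \<sigma> base m k) [2 * k..<2 * m + 2] = (\<Prod>j=k..<m. \<sigma> j) *
    (p (2 * m) + (\<Sum>j=k..<m. pfaff base [2 * j, Suc (2 * j), 2 * m, 2 * m + 1] / \<sigma> j))"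
  using assms(1)
proof (induction k rule: inc_induct)
  case base
  then show ?case by (simp add: block_pert_top upt_conv_Cons rank_four_def)
next
  case (step k)
  have "pfaff (block_pert \<sigma> base m (Suc k)) ([2 * k, Suc (2 * k)] @ [2 * Suc k..<2 * m + 2]) =
    (\<Prod>j=Suc k..<m. \<sigma> j) * pfaff base [2 * k, Suc (2 * k), 2 * m, 2 * m + 1]"
    using step by (intro pfaff_block_pert_pair) auto
  then have "pfaff (block_pert \<sigma> base m k) [2 * k..<2 * m + 2] =
      \<sigma> k * ((\<Prod>j=Suc k..<m. \<sigma> j) *
    (p (2 * m) + (\<Sum>j=Suc k..<m. pfaff base [2 * j, Suc (2 * j), 2 * m, 2 * m + 1] / \<sigma> j)))
     + (\<Prod>j=Suc k..<m. \<sigma> j) * pfaff base [2 * k, Suc (2 * k), 2 * m, 2 * m + 1]"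
    using pfaff_block_step[of "[]" k m \<sigma> base] step by (simp del: pfaff.simps upt_Suc)
  then show ?case
    using step.hyps assms(2)[of k]
    by (simp add: prod.atLeast_Suc_lessThan sum.atLeast_Suc_lessThan field_simps del: pfaff.simps upt_Suc)
qed

end

text \<open>Up to the factor \<open>c\<close> this is the determinant of \<open>p, r, q\<close> at the indices \<open>i, j, k\<close>.\<close>

lemma pfaff_rank_four_4:
  assumes "l \<notin> {i, j, k}"
  shows "pfaff (rank_four l c p r q) [i, j, k, l] =
    c * (p i * (r j * q k - q j * r k) - p j * (r i * q k - q i * r k) + p k * (r i * q j - q i * r j))"
proof -
  have "i \<noteq> l" "j \<noteq> l" "k \<noteq> l"
    using assms by auto
  then show ?thesis
    by (simp add: rank_four_def lessThan_Suc algebra_simps)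
qed

section \<open>The Pfaffian defining the kernel\<close>

lemma dim_V_mat [simp]: "dim_row (V_mat (2 * m)) = 2 * m + 1" "dim_col (V_mat (2 * m)) = 2 * m + 1"
  by (simp_all add: V_mat_def dim_diag_block_mat o_def mat_of_rows_list_def sum_list_triv)

lemma V_mat_upper:
  assumes "i < j" "j < 2 * m + 1"
  shows "V_mat (2 * m) $$ (i, j) = (if even i \<and> j = Suc i \<and> i < 2 * m then sigma_const (i div 2) else 0)"
proof -
  let ?b = "\<lambda>k. mat_of_rows_list 2 [[0, sigma_const k], [- sigma_const k, 0]]"
  let ?D = "\<lambda>ks. diag_block_mat (map ?b ks @ [0\<^sub>m 1 1])"
  have block: "dim_row (?b k) = 2" "dim_col (?b k) = 2" for k
    by (simp_all add: mat_of_rows_list_def)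
  have dim: "dim_row (?D ks) = 2 * length ks + 1" "dim_col (?D ks) = 2 * length ks + 1" for ks
    by (simp_all add: dim_diag_block_mat o_def mat_of_rows_list_def sum_list_triv)
  have "?D ks $$ (i, j) = (if even i \<and> j = Suc i \<and> i < 2 * length ks then sigma_const (ks ! (i div 2)) else 0)"
    if "i < j" "j < 2 * length ks + 1" for ks
    using that
  proof (induction ks arbitrary: i j)
    case Nil
    then show ?case by simp
  next
    case (Cons k ks)
    have D: "?D (k # ks) = four_block_mat (?b k) (0\<^sub>m 2 (2 * length ks + 1))
        (0\<^sub>m (2 * length ks + 1) 2) (?D ks)"
      using dim[of ks] by (simp add: Let_def block)
    (* The entry lies in the first block, to the right of it, or in the remaining blocks. *)
    consider "j = 1" "i = 0" | "j \<ge> 2" "i < 2" | i' j' where "i = i' + 2" "j = j' + 2"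
    proof (cases "i < 2")
      case True
      then show ?thesis using that(1,2) Cons.prems(1) by linarith
    next
      case False
      then show ?thesis using that(3)[of "i - 2" "j - 2"] Cons.prems(1) by simp
    qed
    then show ?case
    proof cases
      case 1
      then show ?thesis unfolding D using dim[of ks] by (simp add: mat_of_rows_list_def)
    next
      case 2
      then show ?thesis unfolding D using dim[of ks] Cons.prems by (auto simp: mat_of_rows_list_def less_2_cases_iff)
    next
      case 3
      then show ?thesis unfolding D using dim[of ks] Cons.prems Cons.IH[of i' j']
        by (simp add: mat_of_rows_list_def)
    qed
  qed
  from this[of "[0..<m]"] show ?thesis
    using assms by (auto simp: V_mat_def)
qed

lemma L_fun_expansion:
  "L_fun (2 * m) x y = 1 / c_const (2 * m) * ((\<Prod>k<m. sigma_const k) *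
    (p_poly (2 * m) x + (\<Sum>k<m. -2 *
      (p_poly (2 * k) x * (r_const (2 * k + 1) * q_fun (2 * m) y - q_fun (2 * k + 1) y * r_const (2 * m))
       - p_poly (2 * k + 1) x * (r_const (2 * k) * q_fun (2 * m) y - q_fun (2 * k) y * r_const (2 * m))
       + p_poly (2 * m) x * (r_const (2 * k) * q_fun (2 * k + 1) y - q_fun (2 * k) y * r_const (2 * k + 1)))
     / sigma_const k)))"
proof -
  let ?d = "2 * m"
  let ?p = "col_mat (p_vec ?d x)" and ?q = "col_mat (q_vec ?d y)" and ?r = "col_mat (r_vec ?d)"
  let ?A = "V_mat ?d - 2 \<cdot>\<^sub>m (?r * transpose_mat ?q - ?q * transpose_mat ?r)"
  let ?M = "four_block_mat ?A ?p (- transpose_mat ?p) (0\<^sub>m 1 1)"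
  let ?base = "rank_four (2 * m + 1) (-2) (\<lambda>n. p_poly n x) r_const (\<lambda>n. q_fun n y)"
  have dimA: "dim_row ?A = ?d + 1" "dim_col ?A = ?d + 1"
    by (simp_all add: col_mat_def r_vec_def q_vec_def)
  have dimM: "dim_row ?M = 2 * (m + 1)"
    using dimA by simp
  have entry: "?M $$ (i, j) = block_pert sigma_const ?base m 0 i j" if "i < j" "j < 2 * (m + 1)" for i j
  proof (cases "j = 2 * m + 1")
    case True
    then show ?thesis
      using that dimA by (simp add: block_pert_def rank_four_def col_mat_def p_vec_def mat_of_cols_def)
  next
    case False
    then have j: "j < 2 * m + 1" "i < 2 * m + 1" using that by auto
    have "?M $$ (i, j) = ?A $$ (i, j)"
      using j dimA by simp
    also have "\<dots> = V_mat ?d $$ (i, j) - 2 * (r_const i * q_fun j y - q_fun i y * r_const j)"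
      using j by (simp add: col_mat_def r_vec_def q_vec_def mat_of_cols_def scalar_prod_def)
    finally show ?thesis
      using False j that(1) by (simp add: V_mat_upper block_pert_def rank_four_def)
  qed
  have "pf ?M = pfaff (\<lambda>i j. ?M $$ (i, j)) [0..<2 * (m + 1)]"
    by (rule pf_eq_pfaff[OF dimM])
  also have "\<dots> = pfaff (block_pert sigma_const ?base m 0) [0..<2 * (m + 1)]"
  proof (rule pfaff_cong)
    fix i j assume "i < j" "j < length [0..<2 * (m + 1)]"
    then show "?M $$ ([0..<2 * (m + 1)] ! i, [0..<2 * (m + 1)] ! j) =
        block_pert sigma_const ?base m 0 ([0..<2 * (m + 1)] ! i) ([0..<2 * (m + 1)] ! j)"
      using entry[of i j] by (simp del: index_mat_four_block upt_Suc)
  qed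
  also have "\<dots> = (\<Prod>j=0..<m. sigma_const j) * (p_poly (2 * m) x +
     (\<Sum>j=0..<m. pfaff ?base [2 * j, Suc (2 * j), 2 * m, 2 * m + 1] / sigma_const j))"
    using pfaff_block_pert[of 0 m sigma_const "-2" "\<lambda>n. p_poly n x" r_const "\<lambda>n. q_fun n y"]
    by (simp add: sigma_const_def del: pfaff.simps upt_Suc)
  also have "\<dots> = (\<Prod>k<m. sigma_const k) *
    (p_poly (2 * m) x + (\<Sum>k<m. -2 *
      (p_poly (2 * k) x * (r_const (2 * k + 1) * q_fun (2 * m) y - q_fun (2 * k + 1) y * r_const (2 * m))
       - p_poly (2 * k + 1) x * (r_const (2 * k) * q_fun (2 * m) y - q_fun (2 * k) y * r_const (2 * m))
       + p_poly (2 * m) x * (r_const (2 * k) * q_fun (2 * k + 1) y - q_fun (2 * k) y * r_const (2 * k + 1)))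
     / sigma_const k))"
  proof -
    have "2 * m + 1 \<notin> {2 * j, Suc (2 * j), 2 * m}" if "j < m" for j
      using that by simp
    then show ?thesis
      by (simp add: pfaff_rank_four_4 atLeast0LessThan del: pfaff.simps)
  qed
  finally show ?thesis
    by (simp add: L_fun_def Let_def)
qed

section \<open>Monic Hermite polynomials\<close>

text \<open>The monic orthogonal polynomials for the weight \<open>exp (- t\<^sup>2)\<close>, given by their three-term recurrence.\<close>

fun mherm :: "nat \<Rightarrow> real poly" where
  "mherm 0 = 1"
| "mherm (Suc 0) = [:0, 1:]"
| "mherm (Suc (Suc n)) = pCons 0 (mherm (Suc n)) - Polynomial.smult (real (Suc n) / 2) (mherm n)"

lemma pderiv_mherm_Suc: "pderiv (mherm (Suc n)) = Polynomial.smult (real (Suc n)) (mherm n)"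
proof (induction n rule: mherm.induct)
  case 1
  then show ?case by (simp add: pderiv_pCons one_pCons)
next
  case 2
  then show ?case by (simp add: pderiv_pCons pderiv_diff pderiv_smult one_pCons)
next
  case (3 n)
  show ?case
    unfolding mherm.simps(3)[of "Suc n"] pderiv_diff pderiv_smult pderiv_pCons 3
      poly_eq_poly_eq_iff[symmetric]
    by (simp add: fun_eq_iff field_simps)
qed

lemma mherm_Suc: "mherm (Suc n) = pCons 0 (mherm n) - Polynomial.smult (1 / 2) (pderiv (mherm n))"
  by (cases n) (simp_all add: pderiv_mherm_Suc one_pCons)

lemma DERIV_std_normal_density:
  "(std_normal_density has_real_derivative - x * std_normal_density x) (at x)"
proof -
  have "((\<lambda>x. exp (- x\<^sup>2 / 2)) has_real_derivative - x * exp (- x\<^sup>2 / 2)) (at x)"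
    by (auto intro!: derivative_eq_intros)
  from DERIV_cmult[OF this, of "1 / sqrt (2 * pi)"] show ?thesis
    by (simp add: std_normal_density_def[abs_def])
qed

text \<open>In the rescaled variable, one more derivative replaces the polynomial factor \<open>P\<close> by
  \<open>t P - P' / 2\<close>, up to a factor \<open>\<surd>2\<close>, and \<open>mherm_Suc\<close> says that this raises the degree of \<open>mherm\<close>.\<close>

lemma iterated_deriv_std_normal:
  "((\<lambda>f t. - deriv f t) ^^ n) std_normal_density =
    (\<lambda>x. 2 powr (real n / 2) * poly (mherm n) (x / sqrt 2) * std_normal_density x)"
proof (induction n)
  case 0
  then show ?case by simp
next
  case (Suc n)
  have "- deriv (\<lambda>x. 2 powr (real n / 2) * poly (mherm n) (x / sqrt 2) * std_normal_density x) x
      = 2 powr (real (Suc n) / 2) * poly (mherm (Suc n)) (x / sqrt 2) * std_normal_density x" for x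
  proof -
    have "((\<lambda>x. 2 powr (real n / 2) * poly (mherm n) (x / sqrt 2) * std_normal_density x) has_real_derivative
       2 powr (real n / 2) * ((poly (pderiv (mherm n)) (x / sqrt 2) * (1 / sqrt 2)) * std_normal_density x
         + poly (mherm n) (x / sqrt 2) * (- x * std_normal_density x))) (at x)"
    proof -
      have "((\<lambda>x. poly (mherm n) (x / sqrt 2)) has_real_derivative
          poly (pderiv (mherm n)) (x / sqrt 2) * (1 / sqrt 2)) (at x)"
        by (rule DERIV_chain'[OF DERIV_cdivide[OF DERIV_ident] poly_DERIV])
      from DERIV_cmult[OF DERIV_mult[OF this DERIV_std_normal_density], of "2 powr (real n / 2)"]
      show ?thesis by (simp only: mult_ac)
    qed
    then have "- deriv (\<lambda>x. 2 powr (real n / 2) * poly (mherm n) (x / sqrt 2) * std_normal_density x) x =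
       2 powr (real n / 2) * (x * poly (mherm n) (x / sqrt 2)
          - poly (pderiv (mherm n)) (x / sqrt 2) * (1 / sqrt 2)) * std_normal_density x"
      by (simp only: DERIV_imp_deriv) (simp add: algebra_simps)
    also have "x * poly (mherm n) (x / sqrt 2) - poly (pderiv (mherm n)) (x / sqrt 2) * (1 / sqrt 2)
        = sqrt 2 * poly (mherm (Suc n)) (x / sqrt 2)"
      by (simp add: mherm_Suc field_simps)
    also have "2 powr (real n / 2) * (sqrt 2 * poly (mherm (Suc n)) (x / sqrt 2))
        = 2 powr (real (Suc n) / 2) * poly (mherm (Suc n)) (x / sqrt 2)"
      by (simp add: add_divide_distrib powr_add powr_half_sqrt)
    finally show ?thesis .
  qed
  then show ?case by (simp add: Suc fun_eq_iff)
qed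

lemma hermite_eq_mherm: "hermite n (sqrt 2 * x) = 2 powr (real n / 2) * poly (mherm n) x"
  using normal_density_pos[of 1 0 "sqrt 2 * x"]
  by (simp add: hermite_def iterated_deriv_std_normal)

lemma monic_hermite: "2 powr (- real n / 2) * hermite n (sqrt 2 * x) = poly (mherm n) x"
  by (simp add: hermite_eq_mherm powr_minus)

lemma p_poly_even: "p_poly (2 * k) x = poly (mherm (2 * k)) x"
  unfolding p_poly_def using monic_hermite[of "2 * k" x] by simp

lemma p_poly_odd:
  "p_poly (2 * k + 1) x = poly (mherm (2 * k + 1)) x - real k * poly (mherm (2 * k - 1)) x"
proof (cases k)
  case 0
  then show ?thesis
    using monic_hermite[of 1 x] by (simp add: p_poly_def)
next
  case (Suc j)
  have n: "2 * k + 1 - 2 = 2 * k - 1" "real (2 * k + 1) - 2 = real (2 * k - 1)"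
      "(real (2 * k + 1) - 1) / 2 = real k"
    by (auto simp: Suc)
  show ?thesis
    unfolding p_poly_def n monic_hermite mult.assoc by simp
qed

section \<open>Gaussian integrals of polynomials\<close>

definition gauss :: "real \<Rightarrow> real" where
  "gauss t = exp (- t\<^sup>2 / 2)"

lemma integrable_poly_gauss: "integrable lborel (\<lambda>t. poly P t * gauss t)"
proof -
  have "integrable lborel (\<lambda>t. Polynomial.coeff P i * t ^ i * gauss t)" for i
  proof -
    have "integrable lborel (\<lambda>t. (Polynomial.coeff P i * sqrt (2 * pi)) * (std_normal_density t * t ^ i))"
      by (intro integrable_mult_right integrable_std_normal_moment)
    then show ?thesis
      by (simp add: std_normal_density_def gauss_def mult_ac)
  qed
  then show ?thesis
    by (simp add: poly_altdef sum_distrib_right)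
qed

lemma set_integrable_poly_gauss:
  "A \<in> sets borel \<Longrightarrow> set_integrable lborel A (\<lambda>t. poly P t * gauss t)"
  unfolding set_integrable_def
  using integrable_mult_indicator[OF _ integrable_poly_gauss, of A P] by simp

lemma tendsto_poly_gauss_at_top: "((\<lambda>t. poly P t * gauss t) \<longlongrightarrow> 0) at_top"
proof -
  have "((\<lambda>t::real. t ^ i * exp (- t\<^sup>2 / 2)) \<longlongrightarrow> 0) at_top" for i
    by real_asymp
  then have "((\<lambda>t. \<Sum>i\<le>degree P. Polynomial.coeff P i * (t ^ i * exp (- t\<^sup>2 / 2))) \<longlongrightarrow> 0) at_top"
    by (intro tendsto_null_sum tendsto_mult_right_zero)
  then show ?thesis
    by (simp add: poly_altdef gauss_def sum_distrib_right mult.assoc)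
qed

lemma tendsto_poly_gauss_at_bot: "((\<lambda>t. poly P t * gauss t) \<longlongrightarrow> 0) at_bot"
  using tendsto_poly_gauss_at_top[of "P \<circ>\<^sub>p [:0, -1:]"]
  by (simp add: filterlim_at_bot_mirror gauss_def poly_pcompose)

definition gauss_tail :: "real poly \<Rightarrow> real \<Rightarrow> real" where
  "gauss_tail P y = (LBINT t:{y<..}. poly P t * gauss t)"

definition gauss_total :: "real poly \<Rightarrow> real" where
  "gauss_total P = (LBINT t. poly P t * gauss t)"

text \<open>Differentiating the product of \<open>P\<close> and \<open>gauss\<close> acts on the polynomial as \<open>P \<mapsto> P' - t P\<close>. Integrals
  of polynomials in the image of this map are boundary values, and every other Hermite integral is
  reduced to one of lower degree by such a polynomial.\<close>

lemma has_vector_derivative_poly_gauss: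
  "((\<lambda>t. - (poly P t * gauss t)) has_vector_derivative poly (pCons 0 P - pderiv P) t * gauss t) (at t)"
  unfolding has_real_derivative_iff_has_vector_derivative[symmetric] gauss_def
  by (auto intro!: derivative_eq_intros poly_DERIV simp: algebra_simps)

lemma isCont_poly_gauss: "isCont (\<lambda>t. poly P t * gauss t) t"
  by (auto simp: gauss_def intro!: continuous_intros)

lemma gauss_tail_deriv: "gauss_tail (pCons 0 P - pderiv P) y = poly P y * gauss y"
proof -
  let ?F = "\<lambda>t. - (poly P t * gauss t)"
  have "(LBINT t=ereal y..\<infinity>. poly (pCons 0 P - pderiv P) t * gauss t) = 0 - ?F y"
  proof (rule interval_integral_FTC_integrable)
    show "set_integrable lborel (einterval (ereal y) \<infinity>) (\<lambda>t. poly (pCons 0 P - pderiv P) t * gauss t)"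
      by (intro set_integrable_poly_gauss) simp
    show "((?F \<circ> real_of_ereal) \<longlongrightarrow> ?F y) (at_right (ereal y))"
      unfolding ereal_tendsto_simps
      using tendsto_minus[OF isCont_poly_gauss[where P=P and t=y, unfolded isCont_def]]
      by (simp add: filterlim_at_split)
    show "((?F \<circ> real_of_ereal) \<longlongrightarrow> 0) (at_left \<infinity>)"
      unfolding ereal_tendsto_simps using tendsto_minus[OF tendsto_poly_gauss_at_top[of P]] by simp
  qed (simp, rule has_vector_derivative_poly_gauss, rule isCont_poly_gauss)
  then show ?thesis
    by (simp add: gauss_tail_def interval_lebesgue_integral_def einterval_eq)
qed

lemma gauss_total_deriv: "gauss_total (pCons 0 P - pderiv P) = 0"
proof -
  let ?F = "\<lambda>t. - (poly P t * gauss t)"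
  have "(LBINT t=-\<infinity>..\<infinity>. poly (pCons 0 P - pderiv P) t * gauss t) = 0 - 0"
  proof (rule interval_integral_FTC_integrable)
    show "set_integrable lborel (einterval (-\<infinity>) \<infinity>) (\<lambda>t. poly (pCons 0 P - pderiv P) t * gauss t)"
      by (intro set_integrable_poly_gauss) simp
    show "((?F \<circ> real_of_ereal) \<longlongrightarrow> 0) (at_right (-\<infinity>))"
      unfolding ereal_tendsto_simps using tendsto_minus[OF tendsto_poly_gauss_at_bot[of P]] by simp
    show "((?F \<circ> real_of_ereal) \<longlongrightarrow> 0) (at_left \<infinity>)"
      unfolding ereal_tendsto_simps using tendsto_minus[OF tendsto_poly_gauss_at_top[of P]] by simp
  qed (simp, rule has_vector_derivative_poly_gauss, rule isCont_poly_gauss)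
  then show ?thesis
    by (simp add: gauss_total_def interval_lebesgue_integral_def einterval_eq set_lebesgue_integral_def)
qed

lemma gauss_tail_diff: "gauss_tail (P - Q) y = gauss_tail P y - gauss_tail Q y"
  unfolding gauss_tail_def
  using set_integral_diff(2)[OF set_integrable_poly_gauss set_integrable_poly_gauss, of "{y<..}" P Q]
  by (simp add: left_diff_distrib)

lemma gauss_tail_smult: "gauss_tail (Polynomial.smult c P) y = c * gauss_tail P y"
  unfolding gauss_tail_def
  by (simp add: mult.assoc)

lemma gauss_total_diff: "gauss_total (P - Q) = gauss_total P - gauss_total Q"
  unfolding gauss_total_def
  by (simp add: left_diff_distrib Bochner_Integration.integral_diff[OF integrable_poly_gauss integrable_poly_gauss])

lemma gauss_total_smult: "gauss_total (Polynomial.smult c P) = c * gauss_total P"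
  unfolding gauss_total_def by (simp add: mult.assoc)

(* Indices such as 2 * Suc k normalise to a double successor and would be unfolded. *)
declare mherm.simps(3) [simp del]

lemma mherm_deriv_eq:
  "pCons 0 (mherm (Suc n)) - pderiv (mherm (Suc n)) = mherm (Suc (Suc n)) - Polynomial.smult (real (Suc n) / 2) (mherm n)"
proof -
  have "Polynomial.smult (real (Suc n)) (mherm n) = Polynomial.smult (real (Suc n) / 2) (mherm n) + Polynomial.smult (real (Suc n) / 2) (mherm n)"
    by (simp add: smult_add_left[symmetric])
  then show ?thesis
    by (simp add: pderiv_mherm_Suc mherm.simps(3))
qed

lemma gauss_tail_mherm_1: "gauss_tail (mherm 1) y = gauss y"
  using gauss_tail_deriv[of 1 y] by (simp add: one_pCons)

lemma gauss_tail_mherm_rec: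
  "gauss_tail (mherm (Suc (Suc n))) y = poly (mherm (Suc n)) y * gauss y + real (Suc n) / 2 * gauss_tail (mherm n) y"
  using gauss_tail_deriv[of "mherm (Suc n)" y] unfolding mherm_deriv_eq gauss_tail_diff gauss_tail_smult by simp

lemma gauss_total_mherm_rec: "gauss_total (mherm (Suc (Suc n))) = real (Suc n) / 2 * gauss_total (mherm n)"
  using gauss_total_deriv[of "mherm (Suc n)"] unfolding mherm_deriv_eq gauss_total_diff gauss_total_smult by simp

lemma gauss_total_mherm_odd: "gauss_total (mherm (2 * k + 1)) = 0"
proof (induction k)
  case 0
  show ?case using gauss_total_deriv[of 1] by (simp add: one_pCons)
next
  case (Suc k)
  then show ?case using gauss_total_mherm_rec[of "2 * k + 1"] by simp
qed

lemma gauss_total_mherm_even: "gauss_total (mherm (2 * k)) = sqrt (2 * pi) * fact (2 * k) / (4 ^ k * fact k)"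
proof (induction k)
  case 0
  have "gauss_total (mherm 0) = (LBINT t. sqrt (2 * pi) * std_normal_density t)"
    unfolding gauss_total_def by (simp add: std_normal_density_def gauss_def)
  then show ?case by simp
next
  case (Suc k)
  have "gauss_total (mherm (2 * Suc k)) = real (Suc (2 * k)) / 2 * gauss_total (mherm (2 * k))"
    using gauss_total_mherm_rec[of "2 * k"] by simp
  also have "\<dots> = real (Suc (2 * k)) / 2 * (sqrt (2 * pi) * fact (2 * k) / (4 ^ k * fact k))"
    unfolding Suc ..
  also have "\<dots> = sqrt (2 * pi) * (real (Suc (2 * k)) * (2 * real (Suc k)) * fact (2 * k)) /
      (4 * 4 ^ k * (real (Suc k) * fact k))"
    by (simp add: divide_simps)
  also have "real (Suc (2 * k)) * (2 * real (Suc k)) * fact (2 * k) = fact (2 * Suc k)"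
    by (simp add: algebra_simps)
  finally show ?case by simp
qed

lemma q_fun_even: "q_fun (2 * k) y = gauss_tail (mherm (2 * k)) y"
  by (simp add: q_fun_def gauss_tail_def p_poly_even gauss_def)

lemma r_const_even: "r_const (2 * k) = gauss_total (mherm (2 * k))"
  by (simp add: r_const_def gauss_total_def p_poly_even gauss_def)

text \<open>The correction term in the odd \<open>p\<^sub>n\<close> puts them into the image of \<open>P \<mapsto> t P - P'\<close>, so that their
  Gaussian integrals are elementary.\<close>

lemma p_poly_odd_eq_poly:
  "p_poly (2 * k + 1) x = poly (pCons 0 (mherm (2 * k)) - pderiv (mherm (2 * k))) x"
proof (cases k)
  case 0
  then show ?thesis using p_poly_odd[of 0 x] by simp
next
  case (Suc j)
  then show ?thesis
    using p_poly_odd[of k x] mherm_deriv_eq[of "Suc (2 * j)"] by (simp del: mherm.simps)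
qed

lemma q_fun_odd: "q_fun (2 * k + 1) y = poly (mherm (2 * k)) y * gauss y"
  using gauss_tail_deriv[of "mherm (2 * k)" y]
  by (simp only: q_fun_def gauss_tail_def p_poly_odd_eq_poly gauss_def)

lemma r_const_odd: "r_const (2 * k + 1) = 0"
  using gauss_total_deriv[of "mherm (2 * k)"]
  by (simp only: r_const_def gauss_total_def p_poly_odd_eq_poly gauss_def)

text \<open>Off the null set \<open>{y}\<close>, \<open>sgn (y - t)\<close> is one minus twice the indicator of \<open>{y<..}\<close>.\<close>

lemma sgn_integral:
  "(LBINT t. gauss t * poly P t * sgn (y - t)) = gauss_total P - 2 * gauss_tail P y"
proof -
  let ?w = "\<lambda>t. poly P t * gauss t"
  have ind: "integrable lborel (\<lambda>t. indicator {y<..} t * ?w t)"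
    using set_integrable_poly_gauss[of "{y<..}" P] by (simp add: set_integrable_def)
  have ae: "AE t in lborel. gauss t * poly P t * sgn (y - t) = ?w t - 2 * (indicator {y<..} t * ?w t)"
    using AE_lborel_singleton[of y] by eventually_elim (auto simp: sgn_if)
  have meas: "?w \<in> borel_measurable borel" "(\<lambda>t. sgn (y - t)) \<in> borel_measurable borel"
    using borel_measurable_integrable[OF integrable_poly_gauss[of P]] by simp_all
  have "(LBINT t. gauss t * poly P t * sgn (y - t)) = (LBINT t. ?w t - 2 * (indicator {y<..} t * ?w t))"
  proof (rule integral_cong_AE[OF _ _ ae])
    show "(\<lambda>t. gauss t * poly P t * sgn (y - t)) \<in> borel_measurable lborel"
      using borel_measurable_times[OF meas] by (simp add: mult_ac)
    show "(\<lambda>t. ?w t - 2 * (indicator {y<..} t * ?w t)) \<in> borel_measurable lborel"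
      using meas(1) by simp
  qed
  also have "\<dots> = gauss_total P - 2 * gauss_tail P y"
    using Bochner_Integration.integral_diff[OF integrable_poly_gauss integrable_mult_right[OF ind, of 2], of P]
    by (simp add: gauss_total_def gauss_tail_def set_lebesgue_integral_def)
  finally show ?thesis .
qed

section \<open>Comparison of the two kernels\<close>

text \<open>Legendre duplication at half-integers; it makes block \<open>k\<close> account for the factors
  \<open>i = 2 k + 1\<close> and \<open>i = 2 k + 2\<close> of \<open>c_const\<close>.\<close>

lemma sigma_const_Gamma: "sigma_const k = 2 * Gamma (real k + 1 / 2) * fact k"
proof (induction k)
  case 0
  then show ?case by (simp add: sigma_const_def Gamma_one_half_real)
next
  case (Suc k)
  have G: "Gamma (real (Suc k) + 1 / 2) = (real k + 1 / 2) * Gamma (real k + 1 / 2)"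
    using Gamma_plus1[of "real k + 1 / 2"] by (simp add: add_ac nonpos_Ints_def)
  have "sigma_const (Suc k) = (real k + 1 / 2) * real (Suc k) * sigma_const k"
    by (simp add: sigma_const_def field_simps)
  then show ?case
    unfolding Suc G by simp
qed

lemma prod_sigma_const: "(\<Prod>k<m. sigma_const k) = c_const (2 * m)"
proof (induction m)
  case 0
  then show ?case by (simp add: c_const_def)
next
  case (Suc m)
  have "c_const (2 * Suc m) = c_const (2 * m) * (2 * Gamma (real m + 1 / 2) * fact m)"
    by (simp add: c_const_def powr_add add_divide_distrib add_ac Gamma_fact[of m, symmetric])
  then show ?case using Suc by (simp add: sigma_const_Gamma)
qed

lemma sum_diff_by_parts:
  fixes a Q :: "nat \<Rightarrow> 'a::comm_ring"
  shows "(\<Sum>k<m. a k * (Q m - Q k)) = (\<Sum>k<m. (\<Sum>j\<le>k. a j) * (Q (Suc k) - Q k))"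
proof (induction m)
  case (Suc m)
  have "(\<Sum>k<Suc m. a k * (Q (Suc m) - Q k))
      = (\<Sum>k<m. a k * (Q m - Q k)) + (\<Sum>k<m. a k * (Q (Suc m) - Q m)) + a m * (Q (Suc m) - Q m)"
    unfolding sum.distrib[symmetric] by (simp add: algebra_simps)
  also have "\<dots> = (\<Sum>k<m. a k * (Q m - Q k)) + (\<Sum>j\<le>m. a j) * (Q (Suc m) - Q m)"
    by (simp add: sum_distrib_right[symmetric] distrib_right lessThan_Suc_atMost[symmetric])
  finally show ?case by (simp add: Suc)
qed simp

text \<open>The correction terms telescope: \<open>k / k! = 1 / (k - 1)!\<close>.\<close>

lemma sum_p_poly_odd:
  "(\<Sum>j\<le>k. p_poly (2 * j + 1) x / fact j) = poly (mherm (2 * k + 1)) x / fact k"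
proof (induction k)
  case 0
  then show ?case using p_poly_odd[of 0 x] by simp
next
  case (Suc k)
  have "p_poly (2 * Suc k + 1) x / fact (Suc k) =
      poly (mherm (2 * Suc k + 1)) x / fact (Suc k) - poly (mherm (2 * k + 1)) x / fact k"
    unfolding p_poly_odd by (simp add: diff_divide_distrib)
  then show ?case using Suc by simp
qed

text \<open>One step of the sum is one step of the recursion \<open>gauss_tail_mherm_rec\<close>, divided by the factorial.\<close>

lemma sum_mherm_even:
  "(\<Sum>k\<le>m. poly (mherm (2 * k)) y * gauss y / fact k) = gauss_tail (mherm (2 * m + 1)) y / fact m"
proof (induction m)
  case 0
  then show ?case using gauss_tail_mherm_1[of y] by simp
next
  case (Suc m)
  have "gauss_tail (mherm (2 * Suc m + 1)) y =
      poly (mherm (2 * Suc m)) y * gauss y + real (Suc m) * gauss_tail (mherm (2 * m + 1)) y"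
    using gauss_tail_mherm_rec[of "2 * m + 1" y] by simp
  then have "gauss_tail (mherm (2 * Suc m + 1)) y / fact (Suc m) =
      poly (mherm (2 * Suc m)) y * gauss y / fact (Suc m) + gauss_tail (mherm (2 * m + 1)) y / fact m"
    by (simp add: add_divide_distrib)
  then show ?case using Suc by simp
qed

lemma gauss_total_mherm_even_pos: "gauss_total (mherm (2 * k)) > 0"
  by (simp add: gauss_total_mherm_even)

lemma two_div_sigma_const: "2 / sigma_const k = sqrt 2 / (fact k * gauss_total (mherm (2 * k)))"
  unfolding gauss_total_mherm_even sigma_const_def power_mult real_sqrt_mult by (simp add: field_simps)

text \<open>Tail and total satisfy the same recursion up to a boundary term; dividing by the total leaves just
  this term.\<close>

lemma tail_ratio_diff:
  "gauss_tail (mherm (2 * Suc k)) y / gauss_total (mherm (2 * Suc k))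
     - gauss_tail (mherm (2 * k)) y / gauss_total (mherm (2 * k))
   = poly (mherm (2 * k + 1)) y * gauss y / gauss_total (mherm (2 * Suc k))"
proof -
  have T: "gauss_tail (mherm (2 * Suc k)) y = poly (mherm (2 * k + 1)) y * gauss y
      + real (Suc (2 * k)) / 2 * gauss_tail (mherm (2 * k)) y"
    using gauss_tail_mherm_rec[of "2 * k" y] by simp
  have R: "gauss_total (mherm (2 * Suc k)) = real (Suc (2 * k)) / 2 * gauss_total (mherm (2 * k))"
    using gauss_total_mherm_rec[of "2 * k"] by simp
  have "(p + a / 2 * t) / (a / 2 * r) - t / r = p / (a / 2 * r)" if "a \<noteq> 0" "r \<noteq> 0" for p a t r :: real
    using that by (simp add: field_simps)
  then show ?thesis
    unfolding T R using gauss_total_mherm_even_pos[of k] by simp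
qed

text \<open>The common value of \<open>L_fun\<close>, without its leading Hermite term, and of \<open>K_tilde\<close>. The
  even degrees below \<open>2 * m\<close>, the odd degrees and the top degree are kept apart because they arise in
  three different ways from the Pfaffian.\<close>

definition common_kernel :: "nat \<Rightarrow> real \<Rightarrow> real \<Rightarrow> real" where
  "common_kernel m x y = sqrt 2 * (
      gauss_total (mherm (2 * m)) * (\<Sum>k<m. poly (mherm (2 * k)) x * poly (mherm (2 * k)) y * gauss y
        / (fact k * gauss_total (mherm (2 * k))))
    + gauss_total (mherm (2 * m)) * (\<Sum>k<m. poly (mherm (2 * k + 1)) x * poly (mherm (2 * k + 1)) y * gauss y
        / (fact k * gauss_total (mherm (2 * Suc k))))
    + poly (mherm (2 * m)) x / fact m *
        (poly (mherm (2 * m)) y * gauss y - gauss_tail (mherm (2 * m + 1)) y))"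

text \<open>The terms with \<open>p_poly (2 * k + 1) x\<close> are summed by parts; those with \<open>p_poly (2 * m) x\<close> have a
  closed form by \<open>sum_mherm_even\<close>.\<close>

lemma L_fun_eq:
  "L_fun (2 * m) x y = poly (mherm (2 * m)) x + common_kernel m x y"
proof -
  define h where "h k = poly (mherm k)" for k
  define R where "R k = gauss_total (mherm (2 * k))" for k
  define T where "T k = gauss_tail (mherm (2 * k)) y" for k
  have R0: "R k \<noteq> 0" for k
    using gauss_total_mherm_even_pos[of k] by (simp add: R_def)
  have c0: "c_const (2 * m) \<noteq> 0"
    by (simp add: prod_sigma_const[symmetric] sigma_const_def)
  have "L_fun (2 * m) x y = h (2 * m) x + (\<Sum>k<m. 2 / sigma_const k *
      (h (2 * k) x * h (2 * k) y * gauss y * R m + p_poly (2 * k + 1) x * (R k * T m - T k * R m)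
        - h (2 * m) x * (R k * h (2 * k) y * gauss y)))"
    unfolding L_fun_expansion r_const_odd q_fun_odd unfolding r_const_even q_fun_even p_poly_even prod_sigma_const
    using c0 by (simp add: h_def R_def T_def algebra_simps add_divide_distrib diff_divide_distrib)
  also have "(\<Sum>k<m. 2 / sigma_const k *
      (h (2 * k) x * h (2 * k) y * gauss y * R m + p_poly (2 * k + 1) x * (R k * T m - T k * R m)
        - h (2 * m) x * (R k * h (2 * k) y * gauss y))) =
      (\<Sum>k<m. sqrt 2 * (R m * (h (2 * k) x * h (2 * k) y * gauss y / (fact k * R k)))
        + sqrt 2 * (R m * (p_poly (2 * k + 1) x / fact k * (T m / R m - T k / R k)))
        - sqrt 2 * (h (2 * m) x * (h (2 * k) y * gauss y / fact k)))"
  proof (rule sum.cong[OF refl])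
    fix k
    show "2 / sigma_const k *
      (h (2 * k) x * h (2 * k) y * gauss y * R m + p_poly (2 * k + 1) x * (R k * T m - T k * R m)
        - h (2 * m) x * (R k * h (2 * k) y * gauss y)) =
      sqrt 2 * (R m * (h (2 * k) x * h (2 * k) y * gauss y / (fact k * R k)))
        + sqrt 2 * (R m * (p_poly (2 * k + 1) x / fact k * (T m / R m - T k / R k)))
        - sqrt 2 * (h (2 * m) x * (h (2 * k) y * gauss y / fact k))"
      unfolding two_div_sigma_const
      using R0[of k] R0[of m] by (simp add: R_def field_simps)
  qed
  also have "\<dots> = sqrt 2 * (R m * (\<Sum>k<m. h (2 * k) x * h (2 * k) y * gauss y / (fact k * R k)))
      + sqrt 2 * (R m * (\<Sum>k<m. p_poly (2 * k + 1) x / fact k * (T m / R m - T k / R k)))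
      - sqrt 2 * (h (2 * m) x * (\<Sum>k<m. h (2 * k) y * gauss y / fact k))"
    by (simp only: sum.distrib sum_subtractf sum_distrib_left)
  also have "(\<Sum>k<m. p_poly (2 * k + 1) x / fact k * (T m / R m - T k / R k))
      = (\<Sum>k<m. h (2 * k + 1) x * h (2 * k + 1) y * gauss y / (fact k * R (Suc k)))"
    unfolding sum_diff_by_parts[of "\<lambda>k. p_poly (2 * k + 1) x / fact k" "\<lambda>k. T k / R k"]
    unfolding sum_p_poly_odd unfolding T_def R_def h_def tail_ratio_diff
    by (simp add: mult.assoc)
  also have "(\<Sum>k<m. h (2 * k) y * gauss y / fact k) =
      (gauss_tail (mherm (2 * m + 1)) y - h (2 * m) y * gauss y) / fact m"
    using sum_mherm_even[of y m]
    by (simp add: h_def lessThan_Suc_atMost[symmetric] diff_divide_distrib)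
  finally show ?thesis
    unfolding common_kernel_def
    by (simp add: algebra_simps diff_divide_distrib h_def R_def)
qed

lemma sum_atMost_even_split:
  fixes f :: "nat \<Rightarrow> 'a::comm_monoid_add"
  shows "(\<Sum>k=0..2 * m. f k) = (\<Sum>k<m. f (2 * k)) + (\<Sum>k<m. f (2 * k + 1)) + f (2 * m)"
  by (induction m) (simp_all add: ac_simps)

text \<open>Here it is only a matter of constants: the even and the odd degrees need the values
  \<open>2\<^sup>k / (\<surd>\<pi> k!)\<close> in terms of the totals, and the integral is a tail because the total of an odd
  degree vanishes.\<close>

lemma K_tilde_eq:
  "K_tilde (2 * m) x y = common_kernel m x y"
proof -
  define h where "h k = poly (mherm k)" for k
  define R where "R k = gauss_total (mherm (2 * k))" for k
  have R0: "R k \<noteq> 0" for k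
    using gauss_total_mherm_even_pos[of k] by (simp add: R_def)
  have even: "2 ^ (2 * k) / (sqrt pi * fact (2 * k)) = sqrt 2 / (fact k * R k)" for k
    using two_div_sigma_const[of k] by (simp add: R_def sigma_const_def)
  have odd: "2 ^ (2 * k + 1) / (sqrt pi * fact (2 * k + 1)) = sqrt 2 / (fact k * R (Suc k))" for k
  proof -
    have R1: "R (Suc k) = real (Suc (2 * k)) / 2 * R k"
      using gauss_total_mherm_rec[of "2 * k"] by (simp add: R_def)
    have "sqrt 2 / (fact k * R (Suc k)) = 2 / real (Suc (2 * k)) * (sqrt 2 / (fact k * R k))"
      unfolding R1 by (simp add: mult_ac)
    also have "\<dots> = 2 ^ (2 * k + 1) / (sqrt pi * fact (2 * k + 1))"
      unfolding even[symmetric] by (simp add: field_simps)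
    finally show ?thesis by simp
  qed
  have Gam: "sqrt (1 / (2 * pi)) * Gamma ((real (2 * m) + 1) / 2) * 2 = R m / sqrt pi"
  proof -
    have "Gamma ((real (2 * m) + 1) / 2) = Gamma (real m + 1 / 2)"
      by (simp add: add_divide_distrib)
    also have "\<dots> = sigma_const m / (2 * fact m)"
      by (simp add: sigma_const_Gamma)
    also have "\<dots> = R m / sqrt 2"
      using two_div_sigma_const[of m] R0[of m] by (simp add: R_def field_simps sigma_const_def)
    finally have G: "Gamma ((real (2 * m) + 1) / 2) = R m / sqrt 2" .
    have "sqrt (1 / (2 * pi)) * (R m / sqrt 2) * 2 = R m * 2 / (sqrt 2 * sqrt pi * sqrt 2)"
      by (simp add: real_sqrt_divide real_sqrt_mult)
    also have "sqrt 2 * sqrt pi * sqrt 2 = 2 * sqrt pi"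
      by simp
    finally show ?thesis
      unfolding G by simp
  qed
  have herm: "hermite k (sqrt 2 * x) * exp (- y\<^sup>2 / 2) * hermite k (sqrt 2 * y) / fact k
      = 2 ^ k / fact k * (h k x * h k y * gauss y)" for k
  proof -
    have "2 ^ k = 2 powr (real k / 2) * (2 powr (real k / 2) :: real)"
      by (simp add: powr_add[symmetric] powr_realpow)
    then show ?thesis
      unfolding hermite_eq_mherm h_def gauss_def by (simp only: mult_ac times_divide_eq_left times_divide_eq_right)
  qed
  have int: "(LBINT t. exp (- t\<^sup>2 / 2) * hermite (2 * m + 1) (sqrt 2 * t) * sgn (y - t))
      = - 2 * (2 powr (real (2 * m + 1) / 2)) * gauss_tail (mherm (2 * m + 1)) y"
  proof -
    have "(LBINT t. exp (- t\<^sup>2 / 2) * hermite (2 * m + 1) (sqrt 2 * t) * sgn (y - t))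
        = (LBINT t. 2 powr (real (2 * m + 1) / 2) * (gauss t * poly (mherm (2 * m + 1)) t * sgn (y - t)))"
      unfolding hermite_eq_mherm gauss_def by (simp only: mult_ac)
    also have "\<dots> = 2 powr (real (2 * m + 1) / 2) * (0 - 2 * gauss_tail (mherm (2 * m + 1)) y)"
      unfolding integral_mult_right_zero sgn_integral gauss_total_mherm_odd ..
    finally show ?thesis by simp
  qed
  have last: "1 / (2 powr (1 / 2) * fact (2 * m)) * hermite (2 * m) (sqrt 2 * x)
         * (- 2 * (2 powr (real (2 * m + 1) / 2)) * gauss_tail (mherm (2 * m + 1)) y)
       = - 2 * (2 ^ (2 * m) / fact (2 * m)) * (h (2 * m) x * gauss_tail (mherm (2 * m + 1)) y)"
  proof -
    have odd_power: "2 powr (real (2 * m + 1) / 2) = 2 powr (1 / 2) * 2 ^ m"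
      by (simp add: add_divide_distrib powr_add powr_realpow)
    have even_power: "2 powr (real (2 * m) / 2) = 2 ^ m"
      by (simp add: powr_realpow)
    have square: "(2::real) ^ (2 * m) = 2 ^ m * 2 ^ m"
      by (simp add: mult_2 power_add)
    have "1 / (c * F) * (P * u) * (- 2 * (c * P) * t) = - 2 * (P * P / F) * (u * t)"
      if "c \<noteq> 0" for c F P u t :: real
      using that by simp
    then show ?thesis
      unfolding hermite_eq_mherm h_def odd_power even_power square by simp
  qed
  let ?g = "\<lambda>k. 2 ^ k / (sqrt pi * fact k) * (h k x * h k y * gauss y)"
  have "K_tilde (2 * m) x y = (sqrt (1 / (2 * pi)) * Gamma ((real (2 * m) + 1) / 2) * 2) *
      ((\<Sum>k=0..2 * m. 2 ^ k / fact k * (h k x * h k y * gauss y))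
      - 2 ^ (2 * m) / fact (2 * m) * (h (2 * m) x * gauss_tail (mherm (2 * m + 1)) y))"
    unfolding K_tilde_def herm int last by (simp add: algebra_simps)
  also have "\<dots> = R m * ((\<Sum>k=0..2 * m. ?g k)
      - 2 ^ (2 * m) / (sqrt pi * fact (2 * m)) * (h (2 * m) x * gauss_tail (mherm (2 * m + 1)) y))"
    unfolding Gam by (simp add: sum_divide_distrib diff_divide_distrib right_diff_distrib sum_distrib_left
      mult_ac)
  also have "\<dots> = R m * ((\<Sum>k<m. ?g (2 * k)) + (\<Sum>k<m. ?g (2 * k + 1)) +
      2 ^ (2 * m) / (sqrt pi * fact (2 * m)) *
        (h (2 * m) x * (h (2 * m) y * gauss y - gauss_tail (mherm (2 * m + 1)) y)))"
    unfolding sum_atMost_even_split by (simp only: algebra_simps)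
  also have "\<dots> = sqrt 2 * (
      R m * (\<Sum>k<m. h (2 * k) x * h (2 * k) y * gauss y / (fact k * R k))
    + R m * (\<Sum>k<m. h (2 * k + 1) x * h (2 * k + 1) y * gauss y / (fact k * R (Suc k)))
    + h (2 * m) x / fact m * (h (2 * m) y * gauss y - gauss_tail (mherm (2 * m + 1)) y))"
    unfolding even odd using R0[of m]
    by (simp add: sum_distrib_left distrib_left mult_ac)
  finally show ?thesis
    unfolding common_kernel_def h_def R_def .
qed

theorem mainTheorem6:
  fixes d :: nat and x y :: real
  assumes "even d" and "d \<ge> 2"
  shows "L_fun d x y = 2 powr (- real d / 2) * hermite d (sqrt 2 * x) + K_tilde d x y"
proof -
  from assms(1) obtain m where "d = 2 * m" ..
  then show ?thesis
    by (simp only: monic_hermite L_fun_eq K_tilde_eq)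
qed

end
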